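(* Let $f \in \mathbb{Z}[x]$ be a polynomial of degree $d$. Then at least one of the polynomials $f(x)+t$, where $t \in \mathbb{Z}$ satisfies $|t| \le \lfloor d/2 \rfloor$, is square-free.
   Context: A polynomial $g \in \mathbb{Z}[x]$ is called square-free if there is no polynomial $h \in \mathbb{Z}[x]$ of degree at least $1$ such that $h^2$ divides $g$ (equivalently, $g$ has no multiple complex roots). *)

theory Defs
  imports "HOL-Computational_Algebra.Polynomial"
begin

text \<open>The library constant \<open>squarefree\<close> would also exclude square constant factors: it is false
  of \<open>4 * [:0, 1:]\<close>, which is square-free in the sense below.  Every nonzero constant is
  square-free here, and the zero polynomial is not.\<close>

definition square_free_int_poly :: "int poly \<Rightarrow> bool" where
  "square_free_int_poly g \<longleftrightarrow> \<not> (\<exists>h :: int poly. degree h \<ge> 1 \<and> h ^ 2 dvd g)"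

end

theory Submission
  imports Defs "HOL-Computational_Algebra.Fundamental_Theorem_Algebra"
begin

text \<open>If \<open>h\<^sup>2\<close> divides \<open>f + t\<close>, then any complex root \<open>z\<close> of \<open>h\<close> satisfies \<open>f(z) = -t\<close> and
  \<open>f'(z) = 0\<close>.  Roots belonging to different values of \<open>t\<close> are therefore distinct, while the nonzero
  polynomial \<open>f'\<close> has at most \<open>d - 1\<close> roots, fewer than the \<open>2\<lfloor>d/2\<rfloor> + 1\<close> admissible values of \<open>t\<close>.\<close>

lemma map_poly_of_int_mult:
  "map_poly (of_int :: int \<Rightarrow> 'a :: comm_ring_1) (p * q) = map_poly of_int p * map_poly of_int q"
  by (intro poly_eqI) (simp add: coeff_map_poly coeff_mult)

lemma map_poly_of_int_add_const:
  "map_poly (of_int :: int \<Rightarrow> 'a :: comm_ring_1) (p + [:c:]) = map_poly of_int p + [:of_int c:]"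
  by (intro poly_eqI) (simp add: coeff_map_poly coeff_pCons split: nat.split)

text \<open>Since \<open>of_int\<close> is injective, a factor \<open>h\<close> of positive degree
  keeps its degree over the complex numbers and so has a root there. As \<open>h\<close> divides
  \<open>g\<close> twice, the product rule leaves a factor \<open>?H\<close> in every term of the
  derivative.\<close>

lemma multiple_root_if_not_square_free:
  assumes "\<not> square_free_int_poly g"
  obtains z :: complex where "poly (map_poly of_int g) z = 0" "poly (pderiv (map_poly of_int g)) z = 0"
proof -
  obtain h k where h: "degree h \<ge> 1" and g: "g = h ^ 2 * k"
    using assms by (auto simp: square_free_int_poly_def dvd_def)
  let ?H = "map_poly of_int h :: complex poly"
  have "degree ?H = degree h"
    by (rule degree_map_poly) simp
  then obtain z where "poly ?H z = 0"
    using h fundamental_theorem_of_algebra[of ?H] by (auto simp: constant_degree)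
  moreover have "map_poly of_int g = ?H * (?H * map_poly of_int k)"
    by (simp add: g power2_eq_square mult.assoc map_poly_of_int_mult)
  ultimately show ?thesis
    by (intro that[of z]) (simp_all add: pderiv_mult)
qed

theorem theorem1p2:
  fixes f :: "int poly" and d :: nat
  assumes "f \<noteq> 0" and "degree f = d"
  shows "\<exists>t :: int. \<bar>t\<bar> \<le> \<lfloor>real d / 2\<rfloor> \<and> square_free_int_poly (f + [:t:])"
proof (rule ccontr)
  let ?F = "map_poly of_int f :: complex poly"
  define m where "m = \<lfloor>real d / 2\<rfloor>"
  assume "\<not> ?thesis"
  then have bad: "\<not> square_free_int_poly (f + [:t:])" if "t \<in> {-m..m}" for t
    using that by (auto simp: m_def abs_le_iff)
  have "\<exists>z. poly ?F z = - of_int t \<and> poly (pderiv ?F) z = 0" if "t \<in> {-m..m}" for t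
    by (rule multiple_root_if_not_square_free[OF bad[OF that]])
      (auto simp: map_poly_of_int_add_const pderiv_add pderiv_pCons eq_neg_iff_add_eq_0)
  then obtain r where r: "poly ?F (r t) = - of_int t" "poly (pderiv ?F) (r t) = 0"
    if "t \<in> {-m..m}" for t
    by metis
  have deg: "degree ?F = d"
    using assms(2) by (simp add: degree_map_poly)
  have "0 \<in> {-m..m}"
    by (simp add: m_def)
  have "d \<noteq> 0"
  proof
    assume "d = 0"
    \<comment> \<open>Here \<open>?F\<close> is constant, so its value \<open>0\<close> at
      \<open>r 0\<close> forces \<open>c = 0\<close>, against \<open>f \<noteq> 0\<close>.\<close>
    then obtain c where "f = [:c:]"
      using assms(2) by (metis degree_eq_zeroE)
    then show False
      using r(1)[OF \<open>0 \<in> {-m..m}\<close>] assms(1) by (simp add: map_poly_pCons)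
  qed
  then have nz: "pderiv ?F \<noteq> 0"
    using deg by (simp add: pderiv_eq_0_iff)
  have "inj_on r {-m..m}"
    by (intro inj_onI) (metis r(1) neg_equal_iff_equal of_int_eq_iff)
  then have "card {-m..m} = card (r ` {-m..m})"
    by (simp add: card_image)
  also have "\<dots> \<le> card {z. poly (pderiv ?F) z = 0}"
    using nz r(2) by (intro card_mono poly_roots_finite) auto
  also have "\<dots> \<le> d - 1"
    using card_poly_roots_bound[OF nz] deg by (simp add: degree_pderiv)
  finally have "nat (2 * m + 1) \<le> d - 1"
    by simp
  \<comment> \<open>Equality holds for odd \<open>d\<close>; for even \<open>d\<close> the left side
    is \<open>d + 1\<close>. Either way it exceeds the root bound \<open>d - 1\<close>.\<close>
  moreover have "2 * m + 1 \<ge> int d"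
    unfolding m_def by linarith
  ultimately show False
    using \<open>d \<noteq> 0\<close> by linarith
qed

end
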